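(* Let $m>1$ be an integer, let $\mathbb F$ be an algebraically closed field of characteristic $p>2$, and let $\lambda=(\lambda_1,\dots,\lambda_{2m+1})\in\mathbb F^{2m+1}$. Regard $H^1_*(\mathfrak h_m^\lambda,\mathfrak h_m^\lambda)$ as a subspace of $H^1(\mathfrak h_m,\mathfrak h_m)$, and let $B$ be the explicit basis of $H^1(\mathfrak h_m,\mathfrak h_m)$ given in the context. (1) If $\lambda=0$, then $H^1_*(\mathfrak h_m^\lambda,\mathfrak h_m^\lambda)=H^1(\mathfrak h_m,\mathfrak h_m)$. (2) If $\lambda\ne0$, then $H^1_*(\mathfrak h_m^\lambda,\mathfrak h_m^\lambda)$ is the subspace of $H^1(\mathfrak h_m,\mathfrak h_m)$ spanned by the elements of $B$ other than $e^{2m+1}_{2m+1}+\sum_{i=1}^m e^i_i$.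
   Context: **Heisenberg algebra.** $\mathfrak h_m$ is the Lie algebra over $\mathbb F$ with basis $e_1,\dots,e_{2m+1}$ whose only non-vanishing brackets of basis vectors are $[e_i,e_{m+i}]=e_{2m+1}$ for $1\le i\le m$ (and those forced by antisymmetry). For $\lambda\in\mathbb F^{2m+1}$, $\mathfrak h_m^\lambda$ is $\mathfrak h_m$ with the $[p]$-map determined by $e_i^{[p]}=\lambda_ie_{2m+1}$; for $p>2$ and $g=\sum a_ie_i$ one has $g^{[p]}=\big(\sum_{i=1}^{2m+1}a_i^p\lambda_i\big)e_{2m+1}$. **Cohomology.** $H^1(\mathfrak h_m,\mathfrak h_m)=\ker d^1/\mathrm{im}\,d^0$ is the ordinary first Chevalley–Eilenberg cohomology with adjoint coefficients: $\ker d^1$ is the space of derivations and $\mathrm{im}\,d^0$ the space of inner derivations. The restricted cohomology is $H^1_*(\mathfrak h_m^\lambda,\mathfrak h_m^\lambda)=\ker d^1_*/\mathrm{im}\,d^0$, where $\ker d^1_*$ consists of the derivations $\psi$ satisfying $\psi(g^{[p]})=(\mathrm{ad}\,g)^{p-1}(\psi(g))$ for all $g$; it is a subspace of $H^1(\mathfrak h_m,\mathfrak h_m)$. **The basis $B$.** $e^i_j:\mathfrak h_m\to\mathfrak h_m$ is the linear map sending $e_i$ to $e_j$ and all other basis vectors to $0$. A cocycle also denotes its class. For $m>1$, a basis $B$ of $H^1(\mathfrak h_m,\mathfrak h_m)$ consists of: - $e^{2m+1}_{2m+1}+\sum_{i=1}^m e^i_i$; - $e^i_j-e^{m+j}_{m+i}$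 for $1\le i,j\le m$; - $e^{m+i}_j+e^{m+j}_i$ and $e^i_{m+j}+e^j_{m+i}$ for $1\le i<j\le m$; - $e^{m+i}_i$ and $e^i_{m+i}$ for $1\le i\le m$. *)

theory Defs
  imports
    "HOL-Computational_Algebra.Computational_Algebra"
    "HOL-Library.Function_Algebras"
    "HOL-Library.Set_Algebras"
begin

text \<open>
  A vector of \<open>F^n\<close> is a function \<open>nat \<Rightarrow> 'a\<close> vanishing outside \<open>{1..n}\<close>.  A linear map
  between subspaces of \<open>nat \<Rightarrow> 'a\<close> is required to be \<open>0\<close> off its domain, so that equal maps are
  equal as HOL functions.
\<close>

definition vspace :: "nat \<Rightarrow> (nat \<Rightarrow> 'a::field) set" where
  "vspace n = {x. \<forall>i. i \<notin> {1..n} \<longrightarrow> x i = 0}"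

definition vscale :: "'a::field \<Rightarrow> (nat \<Rightarrow> 'a) \<Rightarrow> nat \<Rightarrow> 'a" where
  "vscale c x = (\<lambda>i. c * x i)"

definition basis_vec :: "nat \<Rightarrow> nat \<Rightarrow> 'a::field" where
  "basis_vec i = (\<lambda>k. if k = i then 1 else 0)"

type_synonym 'a vmap = "(nat \<Rightarrow> 'a) \<Rightarrow> nat \<Rightarrow> 'a"

definition endos :: "(nat \<Rightarrow> 'a::field) set \<Rightarrow> 'a vmap set" where
  "endos L = {\<psi>. (\<forall>x\<in>L. \<psi> x \<in> L) \<and> (\<forall>x. x \<notin> L \<longrightarrow> \<psi> x = 0) \<and>
     (\<forall>x\<in>L. \<forall>y\<in>L. \<psi> (x + y) = \<psi> x + \<psi> y) \<and>
     (\<forall>c. \<forall>x\<in>L. \<psi> (vscale c x) = vscale c (\<psi> x))}"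

subsection \<open>Quotient spaces of spaces of linear maps\<close>

definition mscale :: "'a::field \<Rightarrow> 'a vmap \<Rightarrow> 'a vmap" where
  "mscale c \<psi> = (\<lambda>x. vscale c (\<psi> x))"

text \<open>The elements of \<open>Z / N\<close> are the cosets \<open>\<psi> +o N\<close>; their sum is the elementwise sum of sets.\<close>

definition quotient_space :: "'a::field vmap set \<Rightarrow> 'a vmap set \<Rightarrow> 'a vmap set set" where
  "quotient_space Z N = (\<lambda>\<psi>. \<psi> +o N) ` Z"

text \<open>Adding \<open>N\<close> makes the product with the scalar \<open>0\<close> the coset \<open>N\<close> instead of \<open>{0}\<close>.\<close>

definition coset_scale :: "'a::field vmap set \<Rightarrow> 'a \<Rightarrow> 'a vmap set \<Rightarrow> 'a vmap set" where
  "coset_scale N c X = mscale c ` X + N"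

definition quotient_subspace ::
    "'a::field vmap set \<Rightarrow> 'a vmap set \<Rightarrow> 'a vmap set set \<Rightarrow> bool" where
  "quotient_subspace Z N S \<longleftrightarrow> S \<subseteq> quotient_space Z N \<and> N \<in> S \<and>
     (\<forall>X\<in>S. \<forall>Y\<in>S. X + Y \<in> S) \<and> (\<forall>c. \<forall>X\<in>S. coset_scale N c X \<in> S)"

definition quotient_span ::
    "'a::field vmap set \<Rightarrow> 'a vmap set \<Rightarrow> 'a vmap set set \<Rightarrow> 'a vmap set set" where
  "quotient_span Z N G = quotient_subspace Z N hull G"

subsection \<open>First cohomology with adjoint coefficients\<close>

definition derivations ::
    "(nat \<Rightarrow> 'a::field) set \<Rightarrow> ((nat \<Rightarrow> 'a) \<Rightarrow> (nat \<Rightarrow> 'a) \<Rightarrow> nat \<Rightarrow> 'a) \<Rightarrow> 'a vmap set" where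
  "derivations L br =
     {\<psi> \<in> endos L. \<forall>g\<in>L. \<forall>h\<in>L. \<psi> (br g h) = br (\<psi> g) h + br g (\<psi> h)}"

definition inner_derivations ::
    "(nat \<Rightarrow> 'a::field) set \<Rightarrow> ((nat \<Rightarrow> 'a) \<Rightarrow> (nat \<Rightarrow> 'a) \<Rightarrow> nat \<Rightarrow> 'a) \<Rightarrow> 'a vmap set" where
  "inner_derivations L br = {(\<lambda>x. if x \<in> L then br z x else 0) | z. z \<in> L}"

definition restricted_derivations ::
    "nat \<Rightarrow> (nat \<Rightarrow> 'a::field) set \<Rightarrow> ((nat \<Rightarrow> 'a) \<Rightarrow> (nat \<Rightarrow> 'a) \<Rightarrow> nat \<Rightarrow> 'a) \<Rightarrow>
     ((nat \<Rightarrow> 'a) \<Rightarrow> nat \<Rightarrow> 'a) \<Rightarrow> 'a vmap set" where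
  "restricted_derivations p L br pmap =
     {\<psi> \<in> derivations L br. \<forall>g\<in>L. \<psi> (pmap g) = (br g ^^ (p - 1)) (\<psi> g)}"

subsection \<open>The restricted Heisenberg algebras\<close>

abbreviation heis :: "nat \<Rightarrow> (nat \<Rightarrow> 'a::field) set" where
  "heis m \<equiv> vspace (2 * m + 1)"

definition heis_bracket :: "nat \<Rightarrow> (nat \<Rightarrow> 'a::field) \<Rightarrow> (nat \<Rightarrow> 'a) \<Rightarrow> nat \<Rightarrow> 'a" where
  "heis_bracket m g h =
     vscale (\<Sum>i=1..m. g i * h (m + i) - g (m + i) * h i) (basis_vec (2 * m + 1))"

definition heis_pmap ::
    "nat \<Rightarrow> nat \<Rightarrow> (nat \<Rightarrow> 'a::field) \<Rightarrow> (nat \<Rightarrow> 'a) \<Rightarrow> nat \<Rightarrow> 'a" where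
  "heis_pmap p m lam g = vscale (\<Sum>i=1..2*m+1. g i ^ p * lam i) (basis_vec (2 * m + 1))"

definition heis_class :: "nat \<Rightarrow> 'a::field vmap \<Rightarrow> 'a vmap set" where
  "heis_class m \<psi> = \<psi> +o inner_derivations (heis m) (heis_bracket m)"

definition heis_H1 :: "nat \<Rightarrow> 'a::field vmap set set" where
  "heis_H1 m = quotient_space (derivations (heis m) (heis_bracket m))
     (inner_derivations (heis m) (heis_bracket m))"

text \<open>
  The inner derivations are the same subspace in both quotients, so \<open>restricted_heis_H1\<close> is
  literally a subset of \<open>heis_H1\<close>.
\<close>

definition restricted_heis_H1 ::
    "nat \<Rightarrow> nat \<Rightarrow> (nat \<Rightarrow> 'a::field) \<Rightarrow> 'a vmap set set" where
  "restricted_heis_H1 p m lam = quotient_space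
     (restricted_derivations p (heis m) (heis_bracket m) (heis_pmap p m lam))
     (inner_derivations (heis m) (heis_bracket m))"

definition heis_H1_span :: "nat \<Rightarrow> 'a::field vmap set set \<Rightarrow> 'a vmap set set" where
  "heis_H1_span m = quotient_span (derivations (heis m) (heis_bracket m))
     (inner_derivations (heis m) (heis_bracket m))"

text \<open>\<open>elem_map m i j\<close> sends the \<open>i\<close>-th basis vector to the \<open>j\<close>-th one and all others to \<open>0\<close>.\<close>

definition elem_map :: "nat \<Rightarrow> nat \<Rightarrow> nat \<Rightarrow> 'a::field vmap" where
  "elem_map m i j = (\<lambda>x. if x \<in> heis m then vscale (x i) (basis_vec j) else 0)"

definition heis_grading_cocycle :: "nat \<Rightarrow> 'a::field vmap" where
  "heis_grading_cocycle m = elem_map m (2 * m + 1) (2 * m + 1) + (\<Sum>i=1..m. elem_map m i i)"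

definition heis_H1_basis :: "nat \<Rightarrow> 'a::field vmap set set" where
  "heis_H1_basis m = heis_class m `
     ({heis_grading_cocycle m}
      \<union> {elem_map m i j - elem_map m (m + j) (m + i) | i j. i \<in> {1..m} \<and> j \<in> {1..m}}
      \<union> {elem_map m (m + i) j + elem_map m (m + j) i | i j. 1 \<le> i \<and> i < j \<and> j \<le> m}
      \<union> {elem_map m i (m + j) + elem_map m j (m + i) | i j. 1 \<le> i \<and> i < j \<and> j \<le> m}
      \<union> {elem_map m (m + i) i | i. i \<in> {1..m}}
      \<union> {elem_map m i (m + i) | i. i \<in> {1..m}})"

subsection \<open>The closed formulas agree with the description on basis vectors\<close>

lemma heis_bracket_basis:
  assumes "i \<in> {1..2*m+1}" "j \<in> {1..2*m+1}"
  shows "heis_bracket m (basis_vec i) (basis_vec j) =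
    (if i \<le> m \<and> j = m + i then basis_vec (2 * m + 1)
     else if j \<le> m \<and> i = m + j then - basis_vec (2 * m + 1) else (0 :: nat \<Rightarrow> 'a::field))"
proof -
  have *: "(\<Sum>k=1..m. basis_vec i k * basis_vec j (m + k) - basis_vec i (m + k) * basis_vec j k)
     = ((if i \<le> m \<and> j = m + i then 1 else 0) - (if j \<le> m \<and> i = m + j then 1 else 0) :: 'a)"
  proof -
    have "(\<Sum>k=1..m. basis_vec i k * basis_vec j (m + k) :: 'a)
        = (\<Sum>k=1..m. if k = i then (if j = m + i then 1 else 0) else 0)"
      by (rule sum.cong) (auto simp: basis_vec_def)
    moreover have "(\<Sum>k=1..m. basis_vec i (m + k) * basis_vec j k :: 'a)
        = (\<Sum>k=1..m. if k = j then (if i = m + j then 1 else 0) else 0)"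
      by (rule sum.cong) (auto simp: basis_vec_def)
    ultimately show ?thesis
      using assms by (simp add: sum_subtractf)
  qed
  consider "i \<le> m \<and> j = m + i" "\<not> (j \<le> m \<and> i = m + j)"
    | "\<not> (i \<le> m \<and> j = m + i)" "j \<le> m \<and> i = m + j"
    | "\<not> (i \<le> m \<and> j = m + i)" "\<not> (j \<le> m \<and> i = m + j)"
    using assms by fastforce
  then show ?thesis
    unfolding heis_bracket_def *
    by cases (simp_all only: if_True if_False, auto simp: vscale_def fun_eq_iff)
qed

lemma heis_pmap_basis:
  assumes "i \<in> {1..2*m+1}" "p > 0"
  shows "heis_pmap p m lam (basis_vec i) = vscale (lam i) (basis_vec (2 * m + 1))"
proof -
  have "(\<Sum>k=1..2*m+1. basis_vec i k ^ p * lam k) = (\<Sum>k=1..2*m+1. if k = i then lam i else 0)"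
    using assms(2) by (intro sum.cong) (auto simp: basis_vec_def)
  then show ?thesis
    using assms(1) by (simp add: heis_pmap_def)
qed

lemma heis_pmap_scale: "heis_pmap p m lam (vscale c g) = vscale (c ^ p) (heis_pmap p m lam g)"
proof -
  have "(\<Sum>i=1..2*m+1. vscale c g i ^ p * lam i) = c ^ p * (\<Sum>i=1..2*m+1. g i ^ p * lam i)"
    by (simp only: sum_distrib_left vscale_def power_mult_distrib mult.assoc)
  then show ?thesis
    unfolding heis_pmap_def by (simp only: vscale_def mult.assoc)
qed

lemma heis_pmap_add:
  assumes "CHAR('a::field) = p" "p > 0"
  shows "heis_pmap p m lam (g + h) = heis_pmap p m lam g + heis_pmap p m lam (h :: nat \<Rightarrow> 'a)"
proof -
  have "prime p"
    using assms prime_CHAR_semidom[where ?'a = 'a] by simp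
  then have "(x + y) ^ p = x ^ p + y ^ p" for x y :: 'a
    using assms(1) by (intro freshmans_dream) simp_all
  then have "(\<Sum>i=1..2*m+1. (g + h) i ^ p * lam i)
      = (\<Sum>i=1..2*m+1. g i ^ p * lam i) + (\<Sum>i=1..2*m+1. h i ^ p * lam i)"
    by (simp only: plus_fun_apply distrib_right sum.distrib)
  then show ?thesis
    unfolding heis_pmap_def by (simp only: vscale_def plus_fun_def distrib_right)
qed

lemma heis_pmap_ad:
  assumes "p > 1"
  shows "heis_bracket m (heis_pmap p m lam g) h = (heis_bracket m g ^^ p) h"
proof -
  have z1: "heis_bracket m (vscale c (basis_vec (2 * m + 1))) x = 0" for c :: 'a and x
  proof -
    have "(\<Sum>i=1..m. vscale c (basis_vec (2 * m + 1)) i * x (m + i)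
        - vscale c (basis_vec (2 * m + 1)) (m + i) * x i) = 0"
      by (rule sum.neutral) (simp add: vscale_def basis_vec_def)
    then show ?thesis
      unfolding heis_bracket_def by (simp add: vscale_def fun_eq_iff)
  qed
  have z2: "heis_bracket m x (vscale c (basis_vec (2 * m + 1))) = 0" for c :: 'a and x
  proof -
    have "(\<Sum>i=1..m. x i * vscale c (basis_vec (2 * m + 1)) (m + i)
        - x (m + i) * vscale c (basis_vec (2 * m + 1)) i) = 0"
      by (rule sum.neutral) (simp add: vscale_def basis_vec_def)
    then show ?thesis
      unfolding heis_bracket_def by (simp add: vscale_def fun_eq_iff)
  qed
  obtain q where q: "p = Suc (Suc q)"
    using assms le_Suc_ex[of 2 p] by auto
  have "heis_bracket m g (heis_bracket m g x) = 0" for x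
    unfolding heis_bracket_def[of m g x] by (rule z2)
  then show ?thesis
    unfolding q heis_pmap_def z1 by simp
qed

end

theory Submission
  imports Defs
begin

text \<open>
  Write \<open>z\<close> for the central basis vector \<open>e\<^bsub>2m+1\<^esub>\<close>.  The bracket of two elements and the \<open>p\<close>-th power
  of an element are multiples of \<open>z\<close>.  Hence \<open>(ad g)\<^sup>2 = 0\<close>, and as \<open>p - 1 \<ge> 2\<close> the condition
  on a restricted derivation \<open>\<psi>\<close> says just that \<open>\<psi>\<close> vanishes on all \<open>p\<close>-th powers.  This is void for
  \<open>\<lambda> = 0\<close>.  If some \<open>\<lambda>\<^sub>i\<close> is nonzero then \<open>\<lambda>\<^sub>i z\<close> is a \<open>p\<close>-th power, so the condition becomes
  \<open>\<psi> z = 0\<close> (\<open>restricted_derivations_nonzero\<close>).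

  The bracket is \<open>\<omega>(g, h) z\<close> for an alternating form \<open>\<omega>\<close> with radical spanned by \<open>z\<close>.  For a linear map
  that kills \<open>z\<close>, being a derivation therefore means being skew for \<open>\<omega>\<close>
  (\<open>center_killing_derivations_iff\<close>).  Such a map is determined by two pieces of its matrix.  The
  \<open>z\<close>-coordinates of the images of \<open>e\<^sub>1, \<dots>, e\<^bsub>2m\<^esub>\<close> are arbitrary and form an inner derivation, because
  \<open>\<omega>\<close> is nondegenerate modulo \<open>z\<close>.  The remaining \<open>2m \<times> 2m\<close> block is a symplectic matrix, and averaging it over the involution
  that defines the symplectic algebra writes it as a combination of the maps
  \<open>symplectic_elem_map m i j\<close>; this uses that 2 is invertible.  Up to sign and a factor 2 on the
  diagonal of the off-diagonal blocks, these maps are the elements of the basis other than the grading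
  cocycle.  So the derivations that kill \<open>z\<close> are spanned by these elements and the inner derivations
  (\<open>center_killing_derivations_span\<close>), which is the claim before passing to the quotient;
  \<open>quotient_span_cosets\<close> carries it over.  The grading cocycle fixes \<open>z\<close> while inner derivations kill
  it, so its class is not the class of another basis element.
\<close>

section \<open>Linear maps and spans in quotient spaces\<close>

interpretation vmaps: vector_space "mscale :: 'a::field \<Rightarrow> 'a vmap \<Rightarrow> 'a vmap"
  by unfold_locales (auto simp: mscale_def vscale_def fun_eq_iff algebra_simps)

lemma vscale_apply: "vscale c x k = c * x k"
  by (simp add: vscale_def)

lemma mscale_apply: "mscale c \<psi> x k = c * \<psi> x k"
  by (simp add: mscale_def vscale_def)

lemma sum_apply: "(\<Sum>i\<in>I. f i) x = (\<Sum>i\<in>I. f i x)"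
  by (induction I rule: infinite_finite_induct) auto

lemma coset_eq_iff:
  assumes "vmaps.subspace N"
  shows "\<psi> +o N = \<phi> +o N \<longleftrightarrow> \<psi> - \<phi> \<in> N"
proof
  assume "\<psi> +o N = \<phi> +o N"
  moreover have "\<psi> \<in> \<psi> +o N"
    using vmaps.subspace_0[OF assms] by (auto simp: elt_set_plus_def)
  ultimately show "\<psi> - \<phi> \<in> N" by (auto simp: elt_set_plus_def)
next
  assume d: "\<psi> - \<phi> \<in> N"
  have "\<psi> + b = \<phi> + ((\<psi> - \<phi>) + b)" "\<phi> + b = \<psi> + (b - (\<psi> - \<phi>))" for b
    by (simp_all add: algebra_simps)
  then show "\<psi> +o N = \<phi> +o N"
    unfolding elt_set_plus_def
    using vmaps.subspace_add[OF assms d] vmaps.subspace_diff[OF assms _ d] by blast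
qed

lemma coset_add:
  assumes "vmaps.subspace N"
  shows "(\<psi> +o N) + (\<phi> +o N) = (\<psi> + \<phi>) +o N"
proof -
  have "N + N = N"
  proof
    show "N + N \<subseteq> N" using vmaps.subspace_add[OF assms] by (auto elim!: set_plus_elim)
    show "N \<subseteq> N + N"
      using set_zero_plus2[OF vmaps.subspace_0[OF assms]] .
  qed
  then show ?thesis by (simp add: set_plus_rearrange)
qed

lemma coset_scale_coset:
  assumes "vmaps.subspace N"
  shows "coset_scale N c (\<psi> +o N) = mscale c \<psi> +o N"
proof (intro equalityI subsetI)
  fix x assume "x \<in> coset_scale N c (\<psi> +o N)"
  then obtain a b where ab: "a \<in> N" "b \<in> N" and x: "x = mscale c (\<psi> + a) + b"
    unfolding coset_scale_def elt_set_plus_def by (blast elim: set_plus_elim)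
  have "x = mscale c \<psi> + (mscale c a + b)"
    by (simp only: x vmaps.scale_right_distrib add.assoc)
  moreover have "mscale c a + b \<in> N"
    using ab by (intro vmaps.subspace_add[OF assms] vmaps.subspace_scale[OF assms])
  ultimately show "x \<in> mscale c \<psi> +o N"
    by (simp only: set_plus_intro2)
next
  fix x assume "x \<in> mscale c \<psi> +o N"
  then obtain b where b: "b \<in> N" and x: "x = mscale c \<psi> + b"
    unfolding elt_set_plus_def by blast
  have "\<psi> \<in> \<psi> +o N"
    using set_plus_intro2[OF vmaps.subspace_0[OF assms], of \<psi>] by (simp only: add_0_right)
  then show "x \<in> coset_scale N c (\<psi> +o N)"
    unfolding coset_scale_def x using b by (intro set_plus_intro imageI)
qed

text \<open>
  Subspaces of a quotient are exactly the images of the subspaces containing \<open>N\<close>, so generating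
  commutes with the projection.
\<close>

lemma quotient_span_cosets:
  assumes N: "vmaps.subspace N" and Z: "vmaps.span (G \<union> N) \<subseteq> Z"
  shows "quotient_span Z N ((\<lambda>\<psi>. \<psi> +o N) ` G) = quotient_space (vmaps.span (G \<union> N)) N"
    (is "?L = ?R")
proof
  have coset_N: "\<psi> +o N = N" if "\<psi> \<in> N" for \<psi>
    using coset_eq_iff[OF N, of \<psi> 0] that by simp
  have "quotient_subspace Z N ?R"
    unfolding quotient_subspace_def
  proof (intro conjI ballI allI)
    show "?R \<subseteq> quotient_space Z N"
      using Z by (auto simp: quotient_space_def)
    have "0 +o N = N" by simp
    then show "N \<in> ?R"
      unfolding quotient_space_def using vmaps.span_zero by (metis imageI)
    show "X + Y \<in> ?R" if "X \<in> ?R" "Y \<in> ?R" for X Y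
      using that unfolding quotient_space_def
      by (auto simp: coset_add[OF N] intro!: image_eqI vmaps.span_add)
    show "coset_scale N c X \<in> ?R" if "X \<in> ?R" for c X
      using that unfolding quotient_space_def
      by (auto simp: coset_scale_coset[OF N] intro!: image_eqI vmaps.span_scale)
  qed
  moreover have "(\<lambda>\<psi>. \<psi> +o N) ` G \<subseteq> ?R"
    using vmaps.span_superset[of "G \<union> N"] by (auto simp: quotient_space_def)
  ultimately show "?L \<subseteq> ?R"
    unfolding quotient_span_def by (intro hull_minimal)
  have "\<psi> +o N \<in> T"
    if T: "quotient_subspace Z N T" and G: "(\<lambda>\<psi>. \<psi> +o N) ` G \<subseteq> T"
      and \<psi>: "\<psi> \<in> vmaps.span (G \<union> N)" for T \<psi>
  proof -
    have NT: "N \<in> T" using T by (simp add: quotient_subspace_def)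
    have add: "X + Y \<in> T" if "X \<in> T" "Y \<in> T" for X Y
      using T that by (simp add: quotient_subspace_def)
    have scale: "coset_scale N c X \<in> T" if "X \<in> T" for c X
      using T that by (simp add: quotient_subspace_def)
    have "vmaps.subspace {\<psi>. \<psi> +o N \<in> T}"
      unfolding vmaps.subspace_def
      using NT add scale by (auto simp flip: coset_add[OF N] coset_scale_coset[OF N])
    moreover have "G \<union> N \<subseteq> {\<psi>. \<psi> +o N \<in> T}"
      using G NT coset_N by auto
    ultimately show ?thesis
      using vmaps.span_minimal \<psi> by blast
  qed
  then show "?R \<subseteq> ?L"
    unfolding quotient_span_def quotient_space_def hull_def by blast
qed

section \<open>Coordinates on the Heisenberg algebra\<close>

lemma vspace_add: "x \<in> vspace n \<Longrightarrow> y \<in> vspace n \<Longrightarrow> x + y \<in> vspace n"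
  by (simp add: vspace_def)

lemma vspace_vscale: "x \<in> vspace n \<Longrightarrow> vscale c x \<in> vspace n"
  by (simp add: vspace_def vscale_def)

lemma basis_vec_in_vspace: "i \<in> {1..n} \<Longrightarrow> basis_vec i \<in> vspace n"
  by (auto simp: vspace_def basis_vec_def)

lemma zero_in_vspace: "0 \<in> vspace n"
  by (simp add: vspace_def)

lemma endos_apply_zero:
  assumes "\<psi> \<in> endos (vspace n)"
  shows "\<psi> 0 = 0"
proof -
  have "\<psi> (0 + 0) = \<psi> 0 + \<psi> 0"
    using assms zero_in_vspace[of n] unfolding endos_def by blast
  then show ?thesis by simp
qed

lemma endos_expand:
  assumes \<psi>: "\<psi> \<in> endos (vspace n)" and x: "x \<in> vspace n"
  shows "\<psi> x = (\<Sum>i=1..n. vscale (x i) (\<psi> (basis_vec i)))"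
proof -
  have add: "\<psi> (u + v) = \<psi> u + \<psi> v" if "u \<in> vspace n" "v \<in> vspace n" for u v
    using \<psi> that by (simp add: endos_def)
  have scale: "\<psi> (vscale c u) = vscale c (\<psi> u)" if "u \<in> vspace n" for c u
    using \<psi> that by (simp add: endos_def)
  \<comment> \<open>Membership is carried along because \<open>\<psi>\<close> is known to be additive only on \<open>vspace n\<close>.\<close>
  have partial: "(\<Sum>i\<in>I. vscale (x i) (basis_vec i)) \<in> vspace n \<and>
     \<psi> (\<Sum>i\<in>I. vscale (x i) (basis_vec i)) = (\<Sum>i\<in>I. vscale (x i) (\<psi> (basis_vec i)))"
    if "finite I" "I \<subseteq> {1..n}" for I
    using that
  proof (induction I rule: finite_induct)
    case empty
    show ?case by (simp only: sum.empty zero_in_vspace endos_apply_zero[OF \<psi>] simp_thms)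
  next
    case (insert i I)
    have b: "vscale (x i) (basis_vec i) \<in> vspace n" "basis_vec i \<in> vspace n"
      using insert.prems by (auto intro!: vspace_vscale basis_vec_in_vspace)
    note IH = insert.IH[OF insert_subset[THEN iffD1, OF insert.prems, THEN conjunct2]]
    show ?case
      unfolding sum.insert[OF insert.hyps] add[OF b(1) conjunct1[OF IH]] scale[OF b(2)]
      using vspace_add[OF b(1) conjunct1[OF IH]] conjunct2[OF IH] by (simp only: simp_thms)
  qed
  have "x = (\<Sum>i=1..n. vscale (x i) (basis_vec i))"
  proof
    fix k
    have "(\<Sum>i=1..n. x i * basis_vec i k) = (\<Sum>i=1..n. if i = k then x k else 0)"
      by (rule sum.cong) (auto simp: basis_vec_def)
    also have "\<dots> = x k" using x by (simp add: vspace_def)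
    finally show "x k = (\<Sum>i=1..n. vscale (x i) (basis_vec i)) k"
      by (simp add: sum_apply vscale_def)
  qed
  then show ?thesis using partial[of "{1..n}"] by simp
qed

lemma elem_map_apply:
  "elem_map m i j x k = (if x \<in> heis m \<and> k = j then x i else 0)"
  by (simp add: elem_map_def vscale_def basis_vec_def)

lemma elem_map_endos:
  assumes "j \<in> {1..2*m+1}"
  shows "elem_map m i j \<in> endos (heis m)"
  using assms
  by (auto simp: endos_def fun_eq_iff elem_map_apply vspace_add vspace_vscale vscale_def
      zero_in_vspace) (auto simp: vspace_def elem_map_def vscale_def basis_vec_def)

lemma subspace_endos: "vmaps.subspace (endos (vspace n))"
  unfolding vmaps.subspace_def
  by (auto simp: endos_def vspace_add vspace_vscale zero_in_vspace mscale_def)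
     (auto simp: vscale_def fun_eq_iff algebra_simps)

lemma endos_eq_sum_elem_maps:
  assumes \<psi>: "\<psi> \<in> endos (heis m)"
  shows "\<psi> = (\<Sum>i=1..2*m+1. \<Sum>j=1..2*m+1. mscale (\<psi> (basis_vec i) j) (elem_map m i j))"
proof (intro ext)
  fix x :: "nat \<Rightarrow> 'a" and k
  have out: "\<psi> (basis_vec i) k = 0" if "i \<in> {1..2*m+1}" "k \<notin> {1..2*m+1}" for i
    using \<psi> basis_vec_in_vspace[OF that(1)] that(2) unfolding endos_def vspace_def by blast
  show "\<psi> x k = (\<Sum>i=1..2*m+1. \<Sum>j=1..2*m+1. mscale (\<psi> (basis_vec i) j) (elem_map m i j)) x k"
  proof (cases "x \<in> heis m")
    case True
    have "(\<Sum>j=1..2*m+1. mscale (\<psi> (basis_vec i) j) (elem_map m i j) x k)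
        = x i * \<psi> (basis_vec i) k" if "i \<in> {1..2*m+1}" for i
    proof -
      have "(\<Sum>j=1..2*m+1. mscale (\<psi> (basis_vec i) j) (elem_map m i j) x k)
        = (\<Sum>j=1..2*m+1. if j = k then x i * \<psi> (basis_vec i) k else 0)"
        using True by (intro sum.cong) (auto simp: mscale_apply elem_map_apply)
      also have "\<dots> = x i * \<psi> (basis_vec i) k"
        using out[OF that] by (simp only: sum.delta finite_atLeastAtMost) auto
      finally show ?thesis .
    qed
    then show ?thesis
      unfolding endos_expand[OF \<psi> True] sum_apply vscale_def by (intro sum.cong) auto
  next
    case False
    then have "\<psi> x = 0" using \<psi> by (simp add: endos_def)
    then show ?thesis
      using False by (simp only: sum_apply mscale_apply elem_map_apply) simp
  qed
qed

section \<open>The symplectic form behind the bracket\<close>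

definition heis_form :: "nat \<Rightarrow> (nat \<Rightarrow> 'a::field) \<Rightarrow> (nat \<Rightarrow> 'a) \<Rightarrow> 'a" where
  "heis_form m g h = (\<Sum>i=1..m. g i * h (m + i) - g (m + i) * h i)"

text \<open>
  \<open>e\<^sub>i\<close> pairs under \<open>heis_form\<close> only with the basis vector at its dual index, and the sign is the
  value of that pairing.  This treats both halves of the symplectic basis at once.  It is meant for
  indices in \<open>{1..2m}\<close>.
\<close>

definition dual_index :: "nat \<Rightarrow> nat \<Rightarrow> nat" where
  "dual_index m i = (if i \<le> m then m + i else i - m)"

definition index_sign :: "nat \<Rightarrow> nat \<Rightarrow> 'a::field" where
  "index_sign m i = (if i \<le> m then 1 else - 1)"

lemma heis_bracket_form: "heis_bracket m g h = vscale (heis_form m g h) (basis_vec (2 * m + 1))"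
  by (simp add: heis_bracket_def heis_form_def)

lemma dual_index_range: "i \<in> {1..2*m} \<Longrightarrow> dual_index m i \<in> {1..2*m}"
  by (auto simp: dual_index_def)

lemma dual_index_involution: "i \<in> {1..2*m} \<Longrightarrow> dual_index m (dual_index m i) = i"
  by (auto simp: dual_index_def)

lemma index_sign_dual: "i \<in> {1..2*m} \<Longrightarrow> index_sign m (dual_index m i) = - index_sign m i"
  by (auto simp: dual_index_def index_sign_def)

lemma index_sign_square: "index_sign m i * index_sign m i = 1"
  by (simp add: index_sign_def)

lemma heis_form_commute: "heis_form m h g = - heis_form m g h"
  by (simp add: heis_form_def sum_negf[symmetric] algebra_simps)

lemma heis_form_add: "heis_form m (g + g') h = heis_form m g h + heis_form m g' h"
  by (simp add: heis_form_def sum.distrib[symmetric] algebra_simps)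

lemma heis_form_scale: "heis_form m (vscale c g) h = c * heis_form m g h"
  by (simp add: heis_form_def vscale_def sum_distrib_left algebra_simps)

lemma heis_form_basis:
  assumes "j \<in> {1..2*m}"
  shows "heis_form m (basis_vec j) h = index_sign m j * h (dual_index m j)"
proof (cases "j \<le> m")
  case True
  have "heis_form m (basis_vec j) h = (\<Sum>i=1..m. if i = j then h (m + j) else 0)"
    unfolding heis_form_def using True assms by (intro sum.cong) (auto simp: basis_vec_def)
  then show ?thesis using True assms by (simp add: dual_index_def index_sign_def)
next
  case False
  have "heis_form m (basis_vec j) h = (\<Sum>i=1..m. if i = j - m then - h (j - m) else 0)"
    unfolding heis_form_def using False assms by (intro sum.cong) (auto simp: basis_vec_def)
  moreover have "j - m \<in> {1..m}" using False assms by auto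
  ultimately show ?thesis using False by (simp add: dual_index_def index_sign_def)
qed

lemma heis_form_add_right: "heis_form m g (h + h') = heis_form m g h + heis_form m g h'"
  by (simp add: heis_form_def sum.distrib[symmetric] algebra_simps)

lemma heis_form_scale_right: "heis_form m g (vscale c h) = c * heis_form m g h"
  by (simp add: heis_form_def vscale_def sum_distrib_left algebra_simps)

lemma heis_form_zero: "heis_form m 0 h = 0" "heis_form m g 0 = 0"
  by (simp_all add: heis_form_def)

lemma heis_form_center:
  assumes "k \<notin> {1..2*m}"
  shows "heis_form m (basis_vec k) h = 0" "heis_form m g (basis_vec k) = 0"
  using assms by (auto simp: heis_form_def basis_vec_def intro!: sum.neutral)

lemma heis_form_bracket:
  "heis_form m (heis_bracket m g h) x = 0" "heis_form m x (heis_bracket m g h) = 0"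
  by (simp_all add: heis_bracket_form heis_form_scale heis_form_scale_right heis_form_center)

lemma heis_bracket_in: "heis_bracket m g h \<in> heis m"
  unfolding heis_bracket_form by (intro vspace_vscale basis_vec_in_vspace) simp

section \<open>Derivations that vanish on the centre\<close>

definition center_killing_derivations :: "nat \<Rightarrow> 'a::field vmap set" where
  "center_killing_derivations m =
     {\<psi> \<in> derivations (heis m) (heis_bracket m). \<psi> (basis_vec (2 * m + 1)) = 0}"

text \<open>
  All brackets are multiples of \<open>z\<close>, so \<open>\<psi>\<close> kills them; what is left of the Leibniz rule is
  infinitesimal invariance of the form.
\<close>

lemma center_killing_derivations_iff:
  "\<psi> \<in> center_killing_derivations m \<longleftrightarrow>
     \<psi> \<in> endos (heis m) \<and> \<psi> (basis_vec (2 * m + 1)) = 0 \<and>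
     (\<forall>g\<in>heis m. \<forall>h\<in>heis m. heis_form m (\<psi> g) h + heis_form m g (\<psi> h) = 0)"
proof -
  have z: "basis_vec (2 * m + 1) \<in> heis m" by (rule basis_vec_in_vspace) simp
  have br: "\<psi> (heis_bracket m g h) = 0"
    if "\<psi> \<in> endos (heis m)" "\<psi> (basis_vec (2 * m + 1)) = 0" for g h
  proof -
    have "\<psi> (heis_bracket m g h) = vscale (heis_form m g h) (\<psi> (basis_vec (2 * m + 1)))"
      using that(1) z unfolding heis_bracket_form endos_def by blast
    then show ?thesis using that(2) by (simp add: vscale_def fun_eq_iff)
  qed
  have sum: "heis_bracket m (\<psi> g) h + heis_bracket m g (\<psi> h) = 0 \<longleftrightarrow>
      heis_form m (\<psi> g) h + heis_form m g (\<psi> h) = 0" for g h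
    by (auto simp: heis_bracket_form vscale_def fun_eq_iff basis_vec_def distrib_right[symmetric])
  show ?thesis
    unfolding center_killing_derivations_def derivations_def
    using br sum by (auto simp: eq_commute[of 0])
qed

lemma subspace_center_killing_derivations: "vmaps.subspace (center_killing_derivations m)"
proof (rule vmaps.subspaceI)
  note E = subspace_endos[of "2 * m + 1", where 'a = 'a]
  show "0 \<in> (center_killing_derivations m :: 'a vmap set)"
    using vmaps.subspace_0[OF E] by (simp add: center_killing_derivations_iff heis_form_zero)
next
  fix \<psi> \<phi> :: "'a vmap"
  assume a: "\<psi> \<in> center_killing_derivations m" "\<phi> \<in> center_killing_derivations m"
  have "heis_form m ((\<psi> + \<phi>) g) h + heis_form m g ((\<psi> + \<phi>) h)
    = (heis_form m (\<psi> g) h + heis_form m g (\<psi> h)) + (heis_form m (\<phi> g) h + heis_form m g (\<phi> h))" for g h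
    by (simp add: heis_form_add heis_form_add_right)
  then show "\<psi> + \<phi> \<in> center_killing_derivations m"
    using a vmaps.subspace_add[OF subspace_endos[where 'a = 'a]]
    unfolding center_killing_derivations_iff by simp
next
  fix c and \<psi> :: "'a vmap"
  assume a: "\<psi> \<in> center_killing_derivations m"
  have "heis_form m (mscale c \<psi> g) h + heis_form m g (mscale c \<psi> h)
    = c * (heis_form m (\<psi> g) h + heis_form m g (\<psi> h))" for g h
    by (simp add: mscale_def heis_form_scale heis_form_scale_right algebra_simps)
  moreover have "mscale c \<psi> x = 0" if "\<psi> x = 0" for x
    using that by (simp add: fun_eq_iff mscale_apply)
  ultimately show "mscale c \<psi> \<in> center_killing_derivations m"
    using a vmaps.subspace_scale[OF subspace_endos[where 'a = 'a]]
    unfolding center_killing_derivations_iff by simp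
qed

lemma inner_derivations_heis:
  "inner_derivations (heis m) (heis_bracket m) \<subseteq> center_killing_derivations m"
proof
  fix \<psi> :: "'a vmap"
  assume "\<psi> \<in> inner_derivations (heis m) (heis_bracket m)"
  then obtain w where \<psi>: "\<psi> = (\<lambda>x. if x \<in> heis m then heis_bracket m w x else 0)"
    by (auto simp: inner_derivations_def)
  have lin: "heis_bracket m w (x + y) = heis_bracket m w x + heis_bracket m w y"
    "heis_bracket m w (vscale c x) = vscale c (heis_bracket m w x)" for x y c
    by (simp_all add: heis_bracket_form heis_form_add_right heis_form_scale_right)
      (simp_all add: vscale_def fun_eq_iff algebra_simps)
  have "heis_bracket m w (basis_vec (2 * m + 1)) = 0"
    by (simp add: heis_bracket_form heis_form_center vscale_def fun_eq_iff)
  then show "\<psi> \<in> center_killing_derivations m"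
    unfolding center_killing_derivations_iff \<psi> endos_def
    using heis_bracket_in[of m w]
    by (auto simp: vspace_add vspace_vscale lin heis_form_bracket)
qed

text \<open>
  \<open>ad\<close> is a linear map, and the inner derivations are its image.
\<close>

lemma subspace_inner_derivations:
  "vmaps.subspace (inner_derivations (heis m) (heis_bracket m))"
proof -
  let ?I = "\<lambda>w x. if x \<in> heis m then heis_bracket m w x else (0 :: nat \<Rightarrow> 'a)"
  have eq: "inner_derivations (heis m) (heis_bracket m) = ?I ` heis m"
    by (auto simp: inner_derivations_def)
  have "0 = ?I 0"
    by (simp add: fun_eq_iff heis_bracket_form heis_form_zero vscale_apply)
  moreover have "?I v + ?I w = ?I (v + w)" for v w
    by (simp add: fun_eq_iff heis_bracket_form heis_form_add vscale_apply algebra_simps)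
  moreover have "mscale c (?I v) = ?I (vscale c v)" for c v
    by (simp add: fun_eq_iff heis_bracket_form heis_form_scale vscale_apply mscale_apply
        vspace_vscale)
  ultimately show ?thesis
    unfolding eq vmaps.subspace_def
    using zero_in_vspace vspace_add vspace_vscale by (auto intro!: image_eqI)
qed

section \<open>Generators of the symplectic algebra\<close>

text \<open>
  \<open>elem_map m i j\<close> minus its adjoint with respect to \<open>heis_form\<close>, hence skew for this form.
\<close>

definition symplectic_elem_map :: "nat \<Rightarrow> nat \<Rightarrow> nat \<Rightarrow> 'a::field vmap" where
  "symplectic_elem_map m i j = elem_map m i j
     - mscale (index_sign m i * index_sign m j) (elem_map m (dual_index m j) (dual_index m i))"

text \<open>
  For \<open>F = symplectic_elem_map m i j\<close> the expression \<open>heis_form m (F g) h\<close> is symmetric in \<open>g\<close> and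
  \<open>h\<close>.  As the form is alternating, this is the invariance required of a derivation.
\<close>

lemma symplectic_elem_map_derivation:
  assumes i: "i \<in> {1..2*m}" and j: "j \<in> {1..2*m}"
  shows "symplectic_elem_map m i j \<in> center_killing_derivations m"
proof -
  let ?F = "symplectic_elem_map m i j :: 'a vmap"
  have form: "heis_form m (?F g) h
      = index_sign m j * (g i * h (dual_index m j) + g (dual_index m j) * h i)"
    if "g \<in> heis m" for g h
  proof -
    have "?F g = vscale (g i) (basis_vec j)
        + vscale (- (index_sign m i * index_sign m j) * g (dual_index m j)) (basis_vec (dual_index m i))"
      using that by (simp add: fun_eq_iff symplectic_elem_map_def elem_map_def mscale_def vscale_def)
    then show ?thesis
      by (simp add: heis_form_add heis_form_scale heis_form_basis[OF j]
          heis_form_basis[OF dual_index_range[OF i]] dual_index_involution[OF i]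
          index_sign_dual[OF i])
        (simp add: index_sign_def algebra_simps)
  qed
  have "?F \<in> endos (heis m)"
    unfolding symplectic_elem_map_def
    using i j dual_index_range[OF i]
    by (intro vmaps.subspace_diff[OF subspace_endos] vmaps.subspace_scale[OF subspace_endos]
        elem_map_endos) auto
  moreover have "?F (basis_vec (2 * m + 1)) = 0"
    using i dual_index_range[OF j]
    by (auto simp: fun_eq_iff symplectic_elem_map_def elem_map_apply mscale_apply basis_vec_def)
  moreover have "heis_form m (?F g) h + heis_form m g (?F h) = 0"
    if "g \<in> heis m" "h \<in> heis m" for g h
    using that by (simp add: heis_form_commute[of m g] form algebra_simps)
  ultimately show ?thesis by (simp add: center_killing_derivations_iff)
qed

text \<open>
  The matrix form of invariance, read off from the pair \<open>e\<^sub>i\<close>, \<open>e\<^sub>k\<close> with \<open>k\<close> the dual index of \<open>j\<close>.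
\<close>

lemma center_killing_derivation_coeff:
  fixes \<psi> :: "'a::field vmap"
  assumes \<psi>: "\<psi> \<in> center_killing_derivations m" and i: "i \<in> {1..2*m}" and j: "j \<in> {1..2*m}"
  shows "\<psi> (basis_vec (dual_index m j)) (dual_index m i)
    = - (index_sign m i * index_sign m j) * \<psi> (basis_vec i) j"
proof -
  note k = dual_index_range[OF j]
  have "heis_form m (\<psi> (basis_vec i)) (basis_vec (dual_index m j))
      + heis_form m (basis_vec i) (\<psi> (basis_vec (dual_index m j))) = 0"
  proof -
    have "basis_vec i \<in> (heis m :: (nat \<Rightarrow> 'a) set)"
      "basis_vec (dual_index m j) \<in> (heis m :: (nat \<Rightarrow> 'a) set)"
      using i k by (auto intro!: basis_vec_in_vspace)
    then show ?thesis using \<psi> unfolding center_killing_derivations_iff by blast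
  qed
  then have "index_sign m j * \<psi> (basis_vec i) j
      + index_sign m i * \<psi> (basis_vec (dual_index m j)) (dual_index m i) = 0"
    by (simp add: heis_form_commute[of m "\<psi> (basis_vec i)"] heis_form_basis[OF i]
        heis_form_basis[OF k] dual_index_involution[OF j] index_sign_dual[OF j])
  then show ?thesis
    by (simp add: index_sign_def add_eq_0_iff split: if_splits)
qed

text \<open>
  By \<open>center_killing_derivation_coeff\<close> the \<open>2m \<times> 2m\<close> block of \<open>\<psi>\<close> is fixed by the involution that
  sends a matrix to minus its adjoint.  It therefore is the average of itself and its image.  Averaging avoids choosing
  a representative of each orbit of index pairs.
\<close>

lemma center_killing_derivation_eq:
  assumes two: "(2 :: 'a::field) \<noteq> 0" and \<psi>: "\<psi> \<in> center_killing_derivations m"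
  shows "\<psi> = (\<Sum>i=1..2*m. \<Sum>j=1..2*m.
      mscale (\<psi> (basis_vec i) j / 2) (symplectic_elem_map m i j :: 'a vmap))
    + (\<Sum>i=1..2*m. mscale (\<psi> (basis_vec i) (2*m+1)) (elem_map m i (2*m+1)))"
proof -
  let ?A = "\<lambda>i j. \<psi> (basis_vec i) j" and ?d = "dual_index m" and ?E = "elem_map m :: _ \<Rightarrow> _ \<Rightarrow> 'a vmap"
  let ?S = "\<Sum>i=1..2*m. \<Sum>j=1..2*m. mscale (?A i j / 2) (?E i j)"
  have bij: "bij_betw ?d {1..2*m} {1..2*m}"
    by (rule bij_betwI[where g = ?d]) (auto simp: dual_index_def)
  note reindex = sum.reindex_bij_betw[OF bij]
  \<comment> \<open>\<open>?S\<close> is half of the block; applying the involution to its index pairs turns it into the part of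
      the symplectic sum that comes from the adjoints.\<close>
  have "(\<Sum>j=1..2*m. \<Sum>i=1..2*m. h (?d j) (?d i)) = (\<Sum>i=1..2*m. \<Sum>j=1..2*m. h i j)"
    for h :: "nat \<Rightarrow> nat \<Rightarrow> 'a vmap"
    using reindex[of "\<lambda>i. \<Sum>j=1..2*m. h i j"] by (simp only: reindex)
  then have "?S = (\<Sum>j=1..2*m. \<Sum>i=1..2*m. mscale (?A (?d j) (?d i) / 2) (?E (?d j) (?d i)))"
    by (rule sym)
  also have "\<dots> = (\<Sum>i=1..2*m. \<Sum>j=1..2*m. mscale (?A (?d j) (?d i) / 2) (?E (?d j) (?d i)))"
    by (rule sum.swap)
  also have "\<dots> = (\<Sum>i=1..2*m. \<Sum>j=1..2*m.
      mscale (?A i j / 2) (symplectic_elem_map m i j) - mscale (?A i j / 2) (?E i j))"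
    by (intro sum.cong refl)
       (simp add: center_killing_derivation_coeff[OF \<psi>] symplectic_elem_map_def
         vmaps.scale_right_diff_distrib)
  finally have "?S = (\<Sum>i=1..2*m. \<Sum>j=1..2*m.
      mscale (?A i j / 2) (symplectic_elem_map m i j)) - ?S"
    by (simp only: sum_subtractf)
  then have avg: "?S + ?S = (\<Sum>i=1..2*m. \<Sum>j=1..2*m.
      mscale (?A i j / 2) (symplectic_elem_map m i j))"
    by (simp only: eq_diff_eq)
  have "a / 2 + a / 2 = a" for a :: 'a
    by (simp only: add_divide_distrib[symmetric] mult_2[symmetric]
        times_divide_eq_right nonzero_mult_div_cancel_left[OF two])
  then have dbl: "?S + ?S = (\<Sum>i=1..2*m. \<Sum>j=1..2*m. mscale (?A i j) (?E i j))"
    by (simp only: sum.distrib[symmetric] vmaps.scale_left_distrib[symmetric])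
  have zero: "?A (2*m+1) j = 0" for j
    using \<psi> by (simp add: center_killing_derivations_iff)
  have split: "(\<Sum>i=1..2*m+1. f i) = (\<Sum>i=1..2*m. f i) + f (2*m+1)" for f :: "nat \<Rightarrow> 'a vmap"
    by simp
  have "\<psi> \<in> endos (heis m)" using \<psi> by (simp add: center_killing_derivations_iff)
  then have "\<psi> = (\<Sum>i=1..2*m+1. \<Sum>j=1..2*m+1. mscale (?A i j) (?E i j))"
    by (rule endos_eq_sum_elem_maps)
  also have "\<dots> = (?S + ?S) + (\<Sum>i=1..2*m. mscale (?A i (2*m+1)) (?E i (2*m+1)))"
    unfolding split zero dbl by (simp only: sum.distrib) simp
  finally show ?thesis by (simp only: avg)
qed

text \<open>
  Since \<open>e\<^sub>i\<close> has a dual basis vector \<open>w\<close>, the \<open>i\<close>-th coordinate is \<open>\<plusminus>\<omega>(w, -)\<close>, which makes the map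
  \<open>\<plusminus>ad w\<close>.
\<close>

lemma elem_map_to_center_inner:
  assumes i: "i \<in> {1..2*m}"
  shows "elem_map m i (2*m+1) \<in> inner_derivations (heis m) (heis_bracket m)"
proof -
  let ?w = "vscale (index_sign m (dual_index m i)) (basis_vec (dual_index m i)) :: nat \<Rightarrow> 'a"
  note d = dual_index_range[OF i]
  have "heis_form m ?w x = x i" for x
    using index_sign_square[of m "dual_index m i", where 'a = 'a]
    by (simp add: heis_form_scale heis_form_basis[OF d] dual_index_involution[OF i]
        mult.assoc[symmetric])
  then have "elem_map m i (2*m+1) = (\<lambda>x. if x \<in> heis m then heis_bracket m ?w x else 0)"
    by (simp only: elem_map_def heis_bracket_form)
  moreover have "?w \<in> heis m"
    using d by (intro vspace_vscale basis_vec_in_vspace) auto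
  ultimately show ?thesis by (auto simp: inner_derivations_def)
qed

definition symplectic_generators :: "nat \<Rightarrow> 'a::field vmap set" where
  "symplectic_generators m =
      {elem_map m i j - elem_map m (m + j) (m + i) | i j. i \<in> {1..m} \<and> j \<in> {1..m}}
      \<union> {elem_map m (m + i) j + elem_map m (m + j) i | i j. 1 \<le> i \<and> i < j \<and> j \<le> m}
      \<union> {elem_map m i (m + j) + elem_map m j (m + i) | i j. 1 \<le> i \<and> i < j \<and> j \<le> m}
      \<union> {elem_map m (m + i) i | i. i \<in> {1..m}}
      \<union> {elem_map m i (m + i) | i. i \<in> {1..m}}"

lemma symplectic_elem_map_cases:
  assumes "i \<in> {1..m}" "j \<in> {1..m}"
  shows "symplectic_elem_map m i j = elem_map m i j - elem_map m (m + j) (m + i)"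
    and "symplectic_elem_map m (m + i) (m + j) = - (elem_map m j i - elem_map m (m + i) (m + j))"
    and "symplectic_elem_map m (m + i) j = elem_map m (m + i) j + elem_map m (m + j) i"
    and "symplectic_elem_map m i (m + j) = elem_map m i (m + j) + elem_map m j (m + i)"
  using assms by (simp_all add: symplectic_elem_map_def index_sign_def dual_index_def)

text \<open>
  In the two off-diagonal blocks the case \<open>i = j\<close> of \<open>symplectic_elem_map\<close> yields twice the
  generator, which is why 2 has to be invertible.
\<close>

lemma symplectic_generators_derivations:
  assumes two: "(2 :: 'a::field) \<noteq> 0"
  shows "symplectic_generators m \<subseteq> (center_killing_derivations m :: 'a vmap set)"
proof -
  let ?D = "center_killing_derivations m :: 'a vmap set"
  have "mscale (1/2) (E + E) = E" for E :: "'a vmap"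
    using two by (simp add: fun_eq_iff mscale_apply)
  then have half: "E \<in> ?D" if "E + E \<in> ?D" for E
    using vmaps.subspace_scale[OF subspace_center_killing_derivations that, of "1/2"] by simp
  have F: "elem_map m i j - elem_map m (m + j) (m + i) \<in> ?D"
    "elem_map m (m + i) j + elem_map m (m + j) i \<in> ?D"
    "elem_map m i (m + j) + elem_map m j (m + i) \<in> ?D"
    if "i \<in> {1..m}" "j \<in> {1..m}" for i j
    using symplectic_elem_map_derivation[of i m j] symplectic_elem_map_derivation[of "m + i" m j]
      symplectic_elem_map_derivation[of i m "m + j"] that
    by (simp_all add: symplectic_elem_map_cases)
  have "elem_map m (m + i) i \<in> ?D" "elem_map m i (m + i) \<in> ?D" if "i \<in> {1..m}" for i
    using half[OF F(2)[OF that that]] half[OF F(3)[OF that that]] .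
  then show ?thesis
    unfolding symplectic_generators_def using F by auto
qed

lemma symplectic_elem_map_in_span:
  assumes i: "i \<in> {1..2*m}" and j: "j \<in> {1..2*m}"
  shows "symplectic_elem_map m i j \<in> vmaps.span (symplectic_generators m :: 'a::field vmap set)"
proof -
  let ?G = "symplectic_generators m :: 'a vmap set"
  have diag: "elem_map m i j - elem_map m (m + j) (m + i) \<in> vmaps.span ?G"
    if "i \<in> {1..m}" "j \<in> {1..m}" for i j
    using that unfolding symplectic_generators_def by (intro vmaps.span_base) blast
  have lower: "elem_map m (m + i) j + elem_map m (m + j) i \<in> vmaps.span ?G"
    and upper: "elem_map m i (m + j) + elem_map m j (m + i) \<in> vmaps.span ?G"
    if "i \<in> {1..m}" "j \<in> {1..m}" for i j
  proof -
    consider "i = j" | "i < j" | "j < i" by linarith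
    then have "elem_map m (m + i) j + elem_map m (m + j) i \<in> vmaps.span ?G \<and>
      elem_map m i (m + j) + elem_map m j (m + i) \<in> vmaps.span ?G"
    proof cases
      case 1
      have "elem_map m (m + j) j \<in> ?G" "elem_map m j (m + j) \<in> ?G"
        using that unfolding symplectic_generators_def by blast+
      then show ?thesis
        unfolding 1 by (intro conjI vmaps.span_add vmaps.span_base)
    next
      case 2
      with that have "1 \<le> i \<and> i < j \<and> j \<le> m" by simp
      then have "elem_map m (m + i) j + elem_map m (m + j) i \<in> ?G"
        "elem_map m i (m + j) + elem_map m j (m + i) \<in> ?G"
        unfolding symplectic_generators_def by blast+
      then show ?thesis by (intro conjI vmaps.span_base)
    next
      case 3
      with that have "1 \<le> j \<and> j < i \<and> i \<le> m" by simp
      then have "elem_map m (m + j) i + elem_map m (m + i) j \<in> ?G"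
        "elem_map m j (m + i) + elem_map m i (m + j) \<in> ?G"
        unfolding symplectic_generators_def by blast+
      then show ?thesis
        unfolding add.commute[of "elem_map m (m + i) j"] add.commute[of "elem_map m i (m + j)"]
        by (intro conjI vmaps.span_base)
    qed
    then show "elem_map m (m + i) j + elem_map m (m + j) i \<in> vmaps.span ?G"
      "elem_map m i (m + j) + elem_map m j (m + i) \<in> vmaps.span ?G" by blast+
  qed
  have split: "k \<in> {1..m} \<or> (\<exists>l\<in>{1..m}. k = m + l)" if "k \<in> {1..2*m}" for k
    using that by (cases "k \<le> m") (auto intro!: bexI[where x = "k - m"])
  consider (a) "i \<in> {1..m}" "j \<in> {1..m}" | (b) l where "i \<in> {1..m}" "l \<in> {1..m}" "j = m + l"
    | (c) k where "k \<in> {1..m}" "i = m + k" "j \<in> {1..m}"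
    | (d) k l where "k \<in> {1..m}" "i = m + k" "l \<in> {1..m}" "j = m + l"
    using split[OF i] split[OF j] by blast
  then show ?thesis
  proof cases
    case a
    then show ?thesis unfolding symplectic_elem_map_cases(1)[OF a] by (rule diag)
  next
    case b
    then show ?thesis
      unfolding b(3) symplectic_elem_map_cases(4)[OF b(1,2)] by (intro upper)
  next
    case c
    then show ?thesis
      unfolding c(2) symplectic_elem_map_cases(3)[OF c(1,3)] by (intro lower)
  next
    case d
    then show ?thesis
      unfolding d(2,4) symplectic_elem_map_cases(2)[OF d(1,3)] by (intro vmaps.span_neg diag)
  qed
qed

lemma center_killing_derivations_span:
  assumes two: "(2 :: 'a::field) \<noteq> 0"
  shows "vmaps.span (symplectic_generators m \<union> inner_derivations (heis m) (heis_bracket m))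
    = (center_killing_derivations m :: 'a vmap set)" (is "vmaps.span (?G \<union> ?N) = ?D")
proof
  show "vmaps.span (?G \<union> ?N) \<subseteq> ?D"
    using symplectic_generators_derivations[OF two] inner_derivations_heis
    by (intro vmaps.span_minimal subspace_center_killing_derivations Un_least)
  show "?D \<subseteq> vmaps.span (?G \<union> ?N)"
  proof
    fix \<psi> assume \<psi>: "\<psi> \<in> ?D"
    have "vmaps.span ?G \<subseteq> vmaps.span (?G \<union> ?N)" by (rule vmaps.span_mono) simp
    then show "\<psi> \<in> vmaps.span (?G \<union> ?N)"
      by (subst center_killing_derivation_eq[OF two \<psi>])
         (intro vmaps.span_add vmaps.span_sum vmaps.span_scale;
          use symplectic_elem_map_in_span elem_map_to_center_inner vmaps.span_base in blast)
  qed
qed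

section \<open>Restricted cohomology\<close>

text \<open>
  The operator \<open>(ad g)\<^sup>2\<close> vanishes and \<open>p - 1 \<ge> 2\<close>.
\<close>

lemma restricted_derivations_heis:
  assumes "p > 2"
  shows "restricted_derivations p (heis m) (heis_bracket m) (heis_pmap p m lam)
    = {\<psi> \<in> derivations (heis m) (heis_bracket m). \<forall>g\<in>heis m. \<psi> (heis_pmap p m lam g) = 0}"
proof -
  have q: "p - 1 = Suc (Suc (p - 3))" using assms by simp
  have sq: "heis_bracket m g (heis_bracket m g x) = 0" for g x :: "nat \<Rightarrow> 'a"
    by (simp add: heis_bracket_form[of m g "heis_bracket m g x"] heis_form_bracket vscale_def
        fun_eq_iff)
  then have "(heis_bracket m g ^^ (p - 1)) x = 0" for g x :: "nat \<Rightarrow> 'a"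
    unfolding q by simp
  then show ?thesis
    unfolding restricted_derivations_def by simp
qed

lemma restricted_derivations_zero:
  assumes "p > 2"
  shows "restricted_derivations p (heis m) (heis_bracket m) (heis_pmap p m 0)
    = derivations (heis m) (heis_bracket m)"
proof -
  have "heis_pmap p m 0 g = 0" for g :: "nat \<Rightarrow> 'a"
    by (simp add: heis_pmap_def vscale_def fun_eq_iff)
  then show ?thesis
    unfolding restricted_derivations_heis[OF assms]
    using endos_apply_zero by (auto simp: derivations_def)
qed

text \<open>
  If \<open>\<lambda>\<^sub>i \<noteq> 0\<close>, the \<open>p\<close>-th power of \<open>e\<^sub>i\<close> spans the line through \<open>z\<close>, and every other \<open>p\<close>-th power
  lies on it.
\<close>

lemma restricted_derivations_nonzero:
  fixes lam :: "nat \<Rightarrow> 'a::field"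
  assumes p: "p > 2" and lam: "lam \<in> heis m" "lam \<noteq> 0"
  shows "restricted_derivations p (heis m) (heis_bracket m) (heis_pmap p m lam)
    = center_killing_derivations m"
proof -
  let ?z = "basis_vec (2 * m + 1) :: nat \<Rightarrow> 'a"
  obtain i where i: "lam i \<noteq> 0" using lam(2) by (auto simp: fun_eq_iff)
  then have i': "i \<in> {1..2*m+1}" using lam(1) by (auto simp: vspace_def)
  have z: "?z \<in> heis m" by (rule basis_vec_in_vspace) simp
  have scale: "\<psi> (vscale c ?z) = vscale c (\<psi> ?z)"
    if "\<psi> \<in> derivations (heis m) (heis_bracket m)" for \<psi> c
    using that z by (simp add: derivations_def endos_def)
  have "\<psi> ?z = 0 \<longleftrightarrow> (\<forall>g\<in>heis m. \<psi> (heis_pmap p m lam g) = 0)"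
    if \<psi>: "\<psi> \<in> derivations (heis m) (heis_bracket m)" for \<psi>
  proof
    assume "\<psi> ?z = 0"
    then show "\<forall>g\<in>heis m. \<psi> (heis_pmap p m lam g) = 0"
      unfolding heis_pmap_def scale[OF \<psi>] by (simp add: vscale_def fun_eq_iff)
  next
    assume "\<forall>g\<in>heis m. \<psi> (heis_pmap p m lam g) = 0"
    then have "\<psi> (heis_pmap p m lam (basis_vec i)) = 0"
      using basis_vec_in_vspace[OF i'] by blast
    then have "vscale (lam i) (\<psi> ?z) = 0"
      using heis_pmap_basis[OF i', of p lam] p scale[OF \<psi>] by simp
    then show "\<psi> ?z = 0" using i by (simp add: vscale_def fun_eq_iff)
  qed
  then show ?thesis
    unfolding restricted_derivations_heis[OF p] center_killing_derivations_def by blast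
qed

text \<open>
  Removing one class from the set of classes could remove several cocycles at once.  It does not, since
  the grading cocycle fixes \<open>z\<close>, whereas the generators and all inner derivations kill it.
\<close>

lemma heis_H1_basis_minus_grading:
  assumes two: "(2 :: 'a::field) \<noteq> 0"
  shows "heis_H1_basis m - {heis_class m (heis_grading_cocycle m)}
    = heis_class m ` (symplectic_generators m :: 'a vmap set)"
proof -
  let ?z = "basis_vec (2 * m + 1) :: nat \<Rightarrow> 'a" and ?gr = "heis_grading_cocycle m :: 'a vmap"
  have z: "?z \<in> heis m" by (rule basis_vec_in_vspace) simp
  have "(\<Sum>i\<in>I. elem_map m i i) ?z = 0" if "I \<subseteq> {1..m}" for I
    using that
    by (induction I rule: infinite_finite_induct)
       (auto simp: elem_map_def basis_vec_def vscale_def fun_eq_iff)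
  then have gr: "?gr ?z = ?z"
    using z by (simp add: heis_grading_cocycle_def elem_map_def basis_vec_def vscale_def)
  have "?z \<noteq> 0" by (auto simp: fun_eq_iff basis_vec_def)
  have "heis_class m ?gr \<noteq> heis_class m \<psi>" if "\<psi> \<in> symplectic_generators m" for \<psi>
  proof
    assume "heis_class m ?gr = heis_class m \<psi>"
    then have "?gr - \<psi> \<in> center_killing_derivations m"
      unfolding heis_class_def coset_eq_iff[OF subspace_inner_derivations]
      using inner_derivations_heis by blast
    moreover have "\<psi> \<in> center_killing_derivations m"
      using that symplectic_generators_derivations[OF two] by blast
    ultimately show False
      using gr \<open>?z \<noteq> 0\<close> by (simp add: center_killing_derivations_def)
  qed
  moreover have "heis_H1_basis m = heis_class m ` ({?gr} \<union> symplectic_generators m)"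
    unfolding heis_H1_basis_def symplectic_generators_def by (simp only: Un_assoc)
  ultimately show ?thesis by (auto simp only: image_Un image_insert image_empty)
qed

theorem proposition3p2:
  fixes lam :: "nat \<Rightarrow> 'a::alg_closed_field" and m p :: nat
  assumes "m > 1"
    and "CHAR('a) = p" and "p > 2"
    and "lam \<in> vspace (2 * m + 1)"
  shows "(lam = 0 \<longrightarrow> restricted_heis_H1 p m lam = heis_H1 m) \<and>
    (lam \<noteq> 0 \<longrightarrow> restricted_heis_H1 p m lam =
      heis_H1_span m (heis_H1_basis m - {heis_class m (heis_grading_cocycle m)}))"
proof (intro conjI impI)
  assume "lam = 0"
  then show "restricted_heis_H1 p m lam = heis_H1 m"
    by (simp only: restricted_heis_H1_def heis_H1_def restricted_derivations_zero[OF \<open>p > 2\<close>])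
next
  assume "lam \<noteq> 0"
  let ?N = "inner_derivations (heis m) (heis_bracket m) :: 'a vmap set"
  have "\<not> CHAR('a) dvd 2"
    using assms(2,3) by (auto dest: dvd_imp_le)
  then have two: "(2 :: 'a) \<noteq> 0"
    using of_nat_eq_0_iff_char_dvd[of 2, where 'a = 'a] by simp
  have "heis_H1_span m (heis_class m ` symplectic_generators m)
      = quotient_space (vmaps.span (symplectic_generators m \<union> ?N)) ?N"
    unfolding heis_H1_span_def heis_class_def
  proof (rule quotient_span_cosets[OF subspace_inner_derivations])
    show "vmaps.span (symplectic_generators m \<union> ?N) \<subseteq> derivations (heis m) (heis_bracket m)"
      unfolding center_killing_derivations_span[OF two] center_killing_derivations_def by blast
  qed
  then show "restricted_heis_H1 p m lam
      = heis_H1_span m (heis_H1_basis m - {heis_class m (heis_grading_cocycle m)})"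
    by (simp only: restricted_heis_H1_def heis_H1_basis_minus_grading[OF two]
        center_killing_derivations_span[OF two]
        restricted_derivations_nonzero[OF \<open>p > 2\<close> assms(4) \<open>lam \<noteq> 0\<close>])
qed

end
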